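(* Let $p$ be a prime and let $G$ be a finite $p$-group of exponent $p$. Then the proper power graph $P^\ast(G)$ is planar if and only if $p \leq 5$.
   Context: A $p$-group of exponent $p$ is a group in which every non-identity element has order $p$. The power graph $P(G)$ of a group $G$ is the simple undirected graph with vertex set $G$ in which two distinct vertices $a,b$ are adjacent if and only if $a\in\langle b\rangle$ or $b\in\langle a\rangle$. The proper power graph $P^\ast(G)$ is the graph obtained from $P(G)$ by deleting the vertex corresponding to the identity element. A graph is planar if it can be drawn in the plane with no edges crossing; equivalently (Kuratowski), if it contains no subgraph that is a subdivision of $K_5$ or $K_{3,3}$. A group of exponent $p$ is understood to be nontrivial. *)

theory Defs
  imports
    "HOL-Analysis.Analysis"
    "HOL-Algebra.Generated_Groups"
    "HOL-Algebra.Multiplicative_Group"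
    "HOL-Computational_Algebra.Primes"
    "Graph_Theory.Digraph"
    "Graph_Theory.Pair_Digraph"
begin

definition group_of_exponent :: "nat \<Rightarrow> ('a, 'm) monoid_scheme \<Rightarrow> bool" where
  "group_of_exponent p G \<longleftrightarrow>
     group G \<and> carrier G \<noteq> {\<one>\<^bsub>G\<^esub>} \<and>
     (\<forall>x \<in> carrier G - {\<one>\<^bsub>G\<^esub>}. group.ord G x = p)"

text \<open>
  Simple undirected graphs are symmetric loop-free digraphs without parallel arcs (the locale
  \<^verbatim>\<open>graph\<close> of \<^verbatim>\<open>Graph_Theory\<close>): an undirected edge is a pair of opposite arcs.
\<close>

definition power_graph :: "('a, 'm) monoid_scheme \<Rightarrow> 'a pair_pre_digraph" where
  "power_graph G =
     \<lparr> pverts = carrier G,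
       parcs = {(a, b). a \<in> carrier G \<and> b \<in> carrier G \<and> a \<noteq> b \<and>
                        (a \<in> generate G {b} \<or> b \<in> generate G {a})} \<rparr>"

definition proper_power_graph :: "('a, 'm) monoid_scheme \<Rightarrow> ('a, 'a \<times> 'a) pre_digraph" where
  "proper_power_graph G = pre_digraph.del_vert (with_proj (power_graph G)) \<one>\<^bsub>G\<^esub>"

lemma graph_proper_power_graph:
  assumes "finite (carrier G)"
  shows "graph (proper_power_graph G)"
proof -
  have fin: "finite {(a, b). a \<in> carrier G \<and> b \<in> carrier G \<and> a \<noteq> b \<and>
                        (a \<in> generate G {b} \<or> b \<in> generate G {a})}"
    by (rule finite_subset[of _ "carrier G \<times> carrier G"]) (use assms in auto)
  interpret P: pair_graph "power_graph G"
    using assms fin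
    by unfold_locales (auto simp: power_graph_def symmetric_def sym_def)
  interpret Q: wf_digraph "proper_power_graph G"
    unfolding proper_power_graph_def by (rule P.wf_digraph_del_vert)
  show ?thesis
    using assms fin
    by unfold_locales
      (auto simp: proper_power_graph_def power_graph_def pre_digraph.del_vert_simps
         arc_to_ends_def symmetric_def sym_def arcs_ends_def image_iff elim: finite_subset[rotated])
qed

text \<open>
  A drawing in the plane: distinct vertices are sent to distinct points and every edge to a simple
  arc joining its two ends and passing through no other vertex, such that two different edges meet
  at most in a common end. The curves are indexed by the unordered pair of ends, so that the two
  opposite arcs representing an undirected edge are drawn as a single curve.
\<close>

definition planar_drawing ::
    "('a, 'b) pre_digraph \<Rightarrow> ('a \<Rightarrow> complex) \<Rightarrow> ('a set \<Rightarrow> real \<Rightarrow> complex) \<Rightarrow> bool" where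
  "planar_drawing H pos \<gamma> \<longleftrightarrow>
     inj_on pos (verts H) \<and>
     (\<forall>(u, v) \<in> arcs_ends H.
        arc (\<gamma> {u, v}) \<and>
        {pathstart (\<gamma> {u, v}), pathfinish (\<gamma> {u, v})} = {pos u, pos v} \<and>
        path_image (\<gamma> {u, v}) \<inter> pos ` verts H = {pos u, pos v}) \<and>
     (\<forall>(u, v) \<in> arcs_ends H. \<forall>(x, y) \<in> arcs_ends H.
        {u, v} \<noteq> {x, y} \<longrightarrow>
        path_image (\<gamma> {u, v}) \<inter> path_image (\<gamma> {x, y}) \<subseteq> pos ` ({u, v} \<inter> {x, y}))"

definition planar :: "('a, 'b) pre_digraph \<Rightarrow> bool" where
  "planar H \<longleftrightarrow> (\<exists>pos \<gamma>. planar_drawing H pos \<gamma>)"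

end

theory Submission
  imports Defs
begin

text \<open>
  In a group of exponent p two distinct non-identity elements are adjacent iff they generate the same
  subgroup, so the proper power graph is a disjoint union of complete graphs on p - 1 vertices.
  For p at most 5 these components have at most four vertices and translated straight-line drawings
  of K4 do; for larger p there is a K5.

  Given a drawing of K5, invert the plane at one of its vertices. Every other vertex is then joined to
  infinity, hence lies outside each triangle formed by the remaining three. But in a drawing of K4 on
  a, b, c, d with that property, both diagonals of the 4-cycle a c b d lie inside it. By the theta
  curve theorem the diagonal ab cuts the inside into the insides of the triangles abc and abd, and the
  diagonal cd stays in one of them, which puts d inside abc or c inside abd.
\<close>

section \<open>Arcs as point sets, Jordan curves and theta curves in the plane\<close>

section \<open>Theta curves\<close>

text \<open>Only the trace and the ends of an arc are recorded. Cycles then become unions of sets,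
  to which \<open>inside\<close> applies directly, and an undirected edge is the same set in either
  direction.\<close>

definition arc_between :: "complex set \<Rightarrow> complex \<Rightarrow> complex \<Rightarrow> bool" where
  "arc_between S u v \<longleftrightarrow> (\<exists>g. arc g \<and> pathstart g = u \<and> pathfinish g = v \<and> path_image g = S)"

lemma arc_between_sym: "arc_between S u v \<Longrightarrow> arc_between S v u"
  unfolding arc_between_def
  by (metis arc_reversepath path_image_reversepath pathfinish_reversepath pathstart_reversepath)

lemma arc_between_neq: "arc_between S u v \<Longrightarrow> u \<noteq> v"
  unfolding arc_between_def by (metis arc_distinct_ends)

lemma arc_between_ends:
  assumes "arc_between S u v"
  shows "u \<in> S" "v \<in> S"
  using assms unfolding arc_between_def by (auto simp: pathstart_in_path_image pathfinish_in_path_image)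

lemma arc_between_connected: "arc_between S u v \<Longrightarrow> connected S"
  unfolding arc_between_def by (auto simp: connected_arc_image)

lemma arc_between_compact: "arc_between S u v \<Longrightarrow> compact S"
  unfolding arc_between_def by (auto simp: compact_arc_image)

lemma arc_between_connected_interior: "arc_between S u v \<Longrightarrow> connected (S - {u, v})"
  unfolding arc_between_def using connected_simple_path_endless arc_imp_simple_path by blast

lemma arc_between_join:
  assumes "arc_between S u v" "arc_between T v w" "S \<inter> T \<subseteq> {v}"
  shows "arc_between (S \<union> T) u w"
proof -
  obtain g h where g: "arc g" "pathstart g = u" "pathfinish g = v" "path_image g = S"
    and h: "arc h" "pathstart h = v" "pathfinish h = w" "path_image h = T"
    using assms(1,2) unfolding arc_between_def by blast
  show ?thesis
    unfolding arc_between_def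
    by (rule exI[of _ "g +++ h"]) (use g h assms(3) in \<open>auto simp: path_image_join intro!: arc_join\<close>)
qed

lemma arc_between_image:
  assumes "arc_between S u v" "continuous_on S f" "inj_on f S"
  shows "arc_between (f ` S) (f u) (f v)"
proof -
  obtain g where g: "arc g" "pathstart g = u" "pathfinish g = v" "path_image g = S"
    using assms(1) unfolding arc_between_def by blast
  have "arc (f \<circ> g)"
    using g assms(2,3) unfolding arc_def
    by (auto simp: path_continuous_image comp_inj_on path_image_def)
  then show ?thesis
    unfolding arc_between_def
    by (intro exI[of _ "f \<circ> g"]) (use g in \<open>auto simp: path_image_compose pathstart_compose pathfinish_compose\<close>)
qed

text \<open>A connected set with more than one point has no isolated points, and removing finitely
  many points from a set keeps its limit points. This is how the ends of an edge are reached as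
  limits of its interior.\<close>

lemma arc_between_subset_closure:
  assumes "arc_between S u v"
  shows "S \<subseteq> closure (S - {u, v})"
proof
  fix x assume "x \<in> S"
  have "S \<noteq> {y}" for y
    using arc_between_ends[OF assms] arc_between_neq[OF assms] by auto
  then have "x islimpt S"
    using connected_imp_perfect arc_between_connected[OF assms] \<open>x \<in> S\<close> by blast
  moreover have "S \<subseteq> {u, v} \<union> (S - {u, v})"
    by auto
  ultimately have "x islimpt {u, v} \<union> (S - {u, v})"
    using islimpt_subset by blast
  then have "x islimpt S - {u, v}"
    using islimpt_Un_finite[of "{u, v}"] by blast
  then show "x \<in> closure (S - {u, v})"
    by (simp add: closure_def)
qed

text \<open>The Jordan curve theorem for the loop that follows \<open>P\<close> from
  \<open>a\<close> to \<open>b\<close> and returns along \<open>Q\<close>.\<close>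

lemma two_arcs_Jordan:
  assumes "arc_between P a b" "arc_between Q a b" "P \<inter> Q \<subseteq> {a, b}"
  shows "inside (P \<union> Q) \<noteq> {}" "connected (inside (P \<union> Q))" "connected (outside (P \<union> Q))"
    "frontier (inside (P \<union> Q)) = P \<union> Q"
proof -
  obtain g h where g: "arc g" "pathstart g = a" "pathfinish g = b" "path_image g = P"
    and h: "arc h" "pathstart h = b" "pathfinish h = a" "path_image h = Q"
    using assms(1) arc_between_sym[OF assms(2)] unfolding arc_between_def by blast
  have "simple_path (g +++ h)"
    by (rule simple_path_join_loop) (use g h assms(3) in auto)
  moreover have "path_image (g +++ h) = P \<union> Q"
    using g h by (simp add: path_image_join)
  ultimately show "inside (P \<union> Q) \<noteq> {}" "connected (inside (P \<union> Q))" "connected (outside (P \<union> Q))"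
    "frontier (inside (P \<union> Q)) = P \<union> Q"
    using Jordan_inside_outside[of "g +++ h"] g h by auto
qed

text \<open>A connected set that misses \<open>C\<close> stays in one component of the complement,
  and \<open>inside C\<close> is a union of such components.\<close>

lemma connected_subset_inside:
  assumes "connected T" "T \<inter> C = {}" "x \<in> T" "x \<in> inside C"
  shows "T \<subseteq> inside C"
proof
  fix y assume "y \<in> T"
  then have "connected_component (- C) x y"
    using assms by (intro connected_componentI[of T]) auto
  then show "y \<in> inside C"
    using inside_same_component assms(4) by blast
qed

text \<open>A point \<open>x\<close> off \<open>P\<close> and outside both cycles through
  \<open>P\<close> can be joined to a point \<open>y\<close> outside the whole theta curve, avoiding
  either cycle. Since the two cycles meet exactly in the connected set \<open>P\<close>,
  Janiszewski's theorem joins \<open>x\<close> to \<open>y\<close> avoiding both at once, so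
  \<open>x\<close> is not inside the third cycle.\<close>

lemma theta_inside_subset:
  assumes P: "arc_between P a b" and Q: "arc_between Q a b" and R: "arc_between R a b"
    and PQ: "P \<inter> Q \<subseteq> {a, b}" and PR: "P \<inter> R \<subseteq> {a, b}" and QR: "Q \<inter> R \<subseteq> {a, b}"
  shows "inside (Q \<union> R) \<subseteq> inside (P \<union> Q) \<union> inside (P \<union> R) \<union> P"
proof
  fix x assume x: "x \<in> inside (Q \<union> R)"
  show "x \<in> inside (P \<union> Q) \<union> inside (P \<union> R) \<union> P"
  proof (rule ccontr)
    assume nx: "x \<notin> inside (P \<union> Q) \<union> inside (P \<union> R) \<union> P"
    have "x \<notin> Q \<union> R"
      using x inside_no_overlap[of "Q \<union> R"] by blast
    then have xo: "x \<in> outside (P \<union> Q)" "x \<in> outside (P \<union> R)"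
      using nx inside_Un_outside[of "P \<union> Q"] inside_Un_outside[of "P \<union> R"] by blast+
    note comp = arc_between_compact[OF P] arc_between_compact[OF Q] arc_between_compact[OF R]
    have "bounded (P \<union> Q \<union> R)"
      using comp by (simp add: compact_imp_bounded)
    then have "\<not> bounded (outside (P \<union> Q \<union> R))"
      by (rule unbounded_outside)
    then obtain y where y: "y \<in> outside (P \<union> Q \<union> R)"
      by (metis bounded_empty ex_in_conv)
    have yo: "y \<in> outside (P \<union> Q)" "y \<in> outside (P \<union> R)" "y \<in> outside (Q \<union> R)"
      by (rule subsetD[OF outside_mono y], blast)+
    have "connected_component (- ((P \<union> Q) \<union> (P \<union> R))) x y"
    proof (rule Janiszewski)
      show "compact (P \<union> Q)" "closed (P \<union> R)"
        using comp by (auto intro: compact_imp_closed)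
      have "(P \<union> Q) \<inter> (P \<union> R) = P"
        using QR arc_between_ends[OF P] by blast
      then show "connected ((P \<union> Q) \<inter> (P \<union> R))"
        using arc_between_connected[OF P] by simp
      show "connected_component (- (P \<union> Q)) x y"
        by (rule connected_componentI[OF two_arcs_Jordan(3)[OF P Q PQ]])
           (use xo yo outside_no_overlap[of "P \<union> Q"] in blast)+
      show "connected_component (- (P \<union> R)) x y"
        by (rule connected_componentI[OF two_arcs_Jordan(3)[OF P R PR]])
           (use xo yo outside_no_overlap[of "P \<union> R"] in blast)+
    qed
    then have "connected_component (- (Q \<union> R)) x y"
      by (rule connected_component_of_subset) auto
    then have "y \<in> inside (Q \<union> R)"
      using x inside_same_component by blast
    then show False
      using yo(3) inside_Int_outside[of "Q \<union> R"] by blast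
  qed
qed

text \<open>In a theta curve some arc runs inside the cycle of the other two. The points
  \<open>q\<close> and \<open>r\<close> rule out \<open>Q\<close> and \<open>R\<close>, which leaves
  \<open>P\<close>.\<close>

lemma theta_chord_inside:
  assumes P: "arc_between P a b" and Q: "arc_between Q a b" and R: "arc_between R a b"
    and PQ: "P \<inter> Q \<subseteq> {a, b}" and PR: "P \<inter> R \<subseteq> {a, b}" and QR: "Q \<inter> R \<subseteq> {a, b}"
    and q: "q \<in> Q - {a, b}" "q \<notin> inside (P \<union> R)"
    and r: "r \<in> R - {a, b}" "r \<notin> inside (P \<union> Q)"
  shows "P - {a, b} \<subseteq> inside (Q \<union> R)"
proof (rule ccontr)
  assume neg: "\<not> P - {a, b} \<subseteq> inside (Q \<union> R)"
  \<comment> \<open>An arc without its ends is connected, so it lies inside \<open>C\<close>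
    entirely or not at all; one point that is not inside decides.\<close>
  have arc_off: "S \<inter> inside C = {}"
    if S: "arc_between S a b" and C: "a \<in> C" "b \<in> C" "S \<inter> C \<subseteq> {a, b}"
      and out: "\<not> S - {a, b} \<subseteq> inside C" for S C
  proof -
    have "(S - {a, b}) \<inter> C = {}"
      using C(3) by blast
    then have "x \<notin> inside C" if "x \<in> S - {a, b}" for x
      using connected_subset_inside[OF arc_between_connected_interior[OF S] _ that] out by blast
    moreover have "a \<notin> inside C" "b \<notin> inside C"
      using inside_no_overlap[of C] C by blast+
    ultimately show ?thesis
      by blast
  qed
  note ends = arc_between_ends[OF P] arc_between_ends[OF Q] arc_between_ends[OF R]
  have P_off: "P \<inter> inside (Q \<union> R) = {}"
    by (rule arc_off[OF P]) (use ends PQ PR neg in auto)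
  have Q_off: "Q \<inter> inside (P \<union> R) = {}"
    by (rule arc_off[OF Q]) (use ends PQ QR q in auto)
  have R_off: "R \<inter> inside (P \<union> Q) = {}"
    by (rule arc_off[OF R]) (use ends PR QR r in auto)
  note JPQ = two_arcs_Jordan[OF P Q PQ] and JPR = two_arcs_Jordan[OF P R PR]
    and JQR = two_arcs_Jordan[OF Q R QR]
  \<comment> \<open>If no arc ran inside the cycle of the other two, all insides would be faces of the theta curve;
    Janiszewski's theorem makes two of them coincide, although their frontiers differ.\<close>
  have inside_eq: "inside C = inside D"
    if "connected (inside C)" "connected (inside D)" "inside C \<inter> D = {}" "inside D \<inter> C = {}"
       "x \<in> inside C" "x \<in> inside D" for C D and x :: complex
    using connected_subset_inside[OF that(1,3,5,6)] connected_subset_inside[OF that(2,4,6,5)]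
    by (rule equalityI)
  have QR_off: "inside (Q \<union> R) \<inter> (P \<union> Q) = {}" "inside (Q \<union> R) \<inter> (P \<union> R) = {}"
    using P_off inside_no_overlap[of "Q \<union> R"] by blast+
  have PQ_off: "inside (P \<union> Q) \<inter> (Q \<union> R) = {}"
    using R_off inside_no_overlap[of "P \<union> Q"] by blast
  have PR_off: "inside (P \<union> R) \<inter> (Q \<union> R) = {}"
    using Q_off inside_no_overlap[of "P \<union> R"] by blast
  obtain x where x: "x \<in> inside (Q \<union> R)"
    using JQR(1) by blast
  then have "x \<notin> P"
    using P_off by blast
  then consider "x \<in> inside (P \<union> Q)" | "x \<in> inside (P \<union> R)"
    using subsetD[OF theta_inside_subset[OF P Q R PQ PR QR] x] by blast
  then show False
  proof cases
    case 1
    have "P \<union> Q = Q \<union> R"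
      using inside_eq[OF JPQ(2) JQR(2) PQ_off QR_off(1) 1 x] JPQ(4) JQR(4) by metis
    then show False
      using r PR QR by blast
  next
    case 2
    have "P \<union> R = Q \<union> R"
      using inside_eq[OF JPR(2) JQR(2) PR_off QR_off(2) 2 x] JPR(4) JQR(4) by metis
    then show False
      using q PQ QR by blast
  qed
qed

text \<open>The theta curve theorem \<open>split_inside_simple_closed_curve\<close>, carried over
  from paths to point sets.\<close>

lemma theta_chord_split:
  assumes P: "arc_between P a b" and Q: "arc_between Q a b" and R: "arc_between R a b"
    and PQ: "P \<inter> Q \<subseteq> {a, b}" and PR: "P \<inter> R \<subseteq> {a, b}" and QR: "Q \<inter> R \<subseteq> {a, b}"
    and P_in: "P - {a, b} \<subseteq> inside (Q \<union> R)"
  shows "inside (Q \<union> R) = inside (P \<union> Q) \<union> inside (P \<union> R) \<union> (P - {a, b})"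
proof -
  obtain p where p: "arc p" "pathstart p = a" "pathfinish p = b" "path_image p = P"
    using P unfolding arc_between_def by blast
  obtain q where q: "arc q" "pathstart q = a" "pathfinish q = b" "path_image q = Q"
    using Q unfolding arc_between_def by blast
  obtain r where r: "arc r" "pathstart r = a" "pathfinish r = b" "path_image r = R"
    using R unfolding arc_between_def by blast
  \<comment> \<open>The theorem asks for a point of the chord inside the cycle. An end in the
    closure of the open arc shows that the open arc is nonempty.\<close>
  have "a \<in> closure (P - {a, b})"
    using arc_between_subset_closure[OF P] arc_between_ends(1)[OF P] by (rule subsetD)
  then have "P - {a, b} \<noteq> {}"
    by (metis closure_empty empty_iff)
  then have ne: "path_image p \<inter> inside (path_image q \<union> path_image r) \<noteq> {}"
    unfolding p q r using P_in by blast
  have Int_eq: "path_image q \<inter> path_image r = {a, b}" "path_image q \<inter> path_image p = {a, b}"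
      "path_image r \<inter> path_image p = {a, b}"
    unfolding p q r
    using arc_between_ends[OF P] arc_between_ends[OF Q] arc_between_ends[OF R] PQ PR QR by auto
  note simple = arc_imp_simple_path[OF p(1)] arc_imp_simple_path[OF q(1)] arc_imp_simple_path[OF r(1)]
  show ?thesis
  proof (rule split_inside_simple_closed_curve[OF simple(2) q(2,3) simple(3) r(2,3) simple(1) p(2,3)
        arc_between_neq[OF P] Int_eq ne])
    assume "inside (path_image q \<union> path_image p) \<union> inside (path_image r \<union> path_image p) \<union>
      (path_image p - {a, b}) = inside (path_image q \<union> path_image r)"
    then show ?thesis
      unfolding p q r by (simp only: Un_commute[of P])
  qed
qed

section \<open>Drawings of K4 and the nonplanarity of K5\<close>

section \<open>Drawings of complete graphs\<close>

text \<open>Edges are point sets indexed by unordered pairs, so a drawing can be moved by any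
  injective map that is continuous on its edges. That edges avoid further vertices follows from the
  crossing condition, see \<open>vertex_not_on_edge\<close>.\<close>

definition complete_drawing :: "'v set \<Rightarrow> ('v \<Rightarrow> complex) \<Rightarrow> ('v set \<Rightarrow> complex set) \<Rightarrow> bool" where
  "complete_drawing V pos E \<longleftrightarrow>
     inj_on pos V \<and>
     (\<forall>u\<in>V. \<forall>v\<in>V. u \<noteq> v \<longrightarrow> arc_between (E {u, v}) (pos u) (pos v)) \<and>
     (\<forall>u\<in>V. \<forall>v\<in>V. \<forall>x\<in>V. \<forall>y\<in>V. u \<noteq> v \<longrightarrow> x \<noteq> y \<longrightarrow> {u, v} \<noteq> {x, y} \<longrightarrow>
        E {u, v} \<inter> E {x, y} \<subseteq> pos ` ({u, v} \<inter> {x, y}))"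

lemma complete_drawing_edge:
  assumes "complete_drawing V pos E" "u \<in> V" "v \<in> V" "u \<noteq> v"
  shows "arc_between (E {u, v}) (pos u) (pos v)"
  using assms unfolding complete_drawing_def by blast

lemma complete_drawing_ends:
  assumes "complete_drawing V pos E" "u \<in> V" "v \<in> V" "u \<noteq> v"
  shows "pos u \<in> E {u, v}" "pos v \<in> E {u, v}"
  using arc_between_ends[OF complete_drawing_edge[OF assms]] .

lemma complete_drawing_neq:
  assumes "complete_drawing V pos E" "u \<in> V" "v \<in> V" "u \<noteq> v"
  shows "pos u \<noteq> pos v"
  using arc_between_neq[OF complete_drawing_edge[OF assms]] .

lemma complete_drawing_adjacent:
  assumes D: "complete_drawing V pos E" and "{u, v, w} \<subseteq> V" "distinct [u, v, w]"
  shows "E {u, v} \<inter> E {u, w} \<subseteq> {pos u}" "E {u, v} \<inter> E {v, w} \<subseteq> {pos v}"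
    "E {u, w} \<inter> E {v, w} \<subseteq> {pos w}"
proof -
  have "E {x, y} \<inter> E {x, z} \<subseteq> {pos x}" if "x \<in> V" "y \<in> V" "z \<in> V" "x \<noteq> y" "x \<noteq> z" "y \<noteq> z" for x y z
  proof -
    have "{x, y} \<noteq> {x, z}" and Int: "{x, y} \<inter> {x, z} = {x}"
      using that by auto
    then have "E {x, y} \<inter> E {x, z} \<subseteq> pos ` ({x, y} \<inter> {x, z})"
      using D that unfolding complete_drawing_def by blast
    then show ?thesis
      unfolding Int by simp
  qed
  from this[of u v w] this[of v u w] this[of w u v]
  show "E {u, v} \<inter> E {u, w} \<subseteq> {pos u}" "E {u, v} \<inter> E {v, w} \<subseteq> {pos v}"
    "E {u, w} \<inter> E {v, w} \<subseteq> {pos w}"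
    using assms(2,3) by (auto simp add: insert_commute)
qed

lemma complete_drawing_disjoint:
  assumes D: "complete_drawing V pos E" and "{u, v, w, x} \<subseteq> V" "distinct [u, v, w, x]"
  shows "E {u, v} \<inter> E {w, x} = {}"
proof -
  have "{u, v} \<noteq> {w, x}" and Int: "{u, v} \<inter> {w, x} = {}"
    using assms(3) by auto
  moreover have "u \<in> V" "v \<in> V" "w \<in> V" "x \<in> V" "u \<noteq> v" "w \<noteq> x"
    using assms(2,3) by auto
  ultimately have "E {u, v} \<inter> E {w, x} \<subseteq> pos ` ({u, v} \<inter> {w, x})"
    using D unfolding complete_drawing_def by blast
  then show ?thesis
    unfolding Int by simp
qed

text \<open>Otherwise the edges \<open>{u, v}\<close> and \<open>{u, w}\<close> would meet in
  \<open>pos w\<close>, which differs from their only permitted common point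
  \<open>pos u\<close>.\<close>

lemma vertex_not_on_edge:
  assumes D: "complete_drawing V pos E" and V: "{u, v, w} \<subseteq> V" "distinct [u, v, w]"
  shows "pos w \<notin> E {u, v}"
proof
  assume "pos w \<in> E {u, v}"
  moreover have "pos w \<in> E {u, w}" "pos w \<noteq> pos u"
    using complete_drawing_ends(2)[OF D, of u w] complete_drawing_neq[OF D, of w u] V by auto
  ultimately show False
    using complete_drawing_adjacent(1)[OF D V] by blast
qed

text \<open>The edge from \<open>u\<close> to \<open>v\<close> and the two paths through
  \<open>w\<close> and through \<open>x\<close> form a theta curve. The vertices \<open>w\<close>
  and \<open>x\<close> are the points that keep these two paths from being the chord.\<close>

lemma K4_chord:
  assumes D: "complete_drawing V pos E" and V: "{u, v, w, x} \<subseteq> V" "distinct [u, v, w, x]"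
    and out: "pos w \<notin> inside (E {u, v} \<union> (E {u, x} \<union> E {v, x}))"
      "pos x \<notin> inside (E {u, v} \<union> (E {u, w} \<union> E {v, w}))"
  shows "E {u, v} - {pos u, pos v} \<subseteq> inside ((E {u, w} \<union> E {v, w}) \<union> (E {u, x} \<union> E {v, x}))"
    "inside ((E {u, w} \<union> E {v, w}) \<union> (E {u, x} \<union> E {v, x})) =
       inside (E {u, v} \<union> (E {u, w} \<union> E {v, w})) \<union> inside (E {u, v} \<union> (E {u, x} \<union> E {v, x}))
       \<union> (E {u, v} - {pos u, pos v})"
proof -
  have via: "arc_between (E {u, y} \<union> E {v, y}) (pos u) (pos v)"
      "E {u, v} \<inter> (E {u, y} \<union> E {v, y}) \<subseteq> {pos u, pos v}"
      "pos y \<in> E {u, y} \<union> E {v, y} - {pos u, pos v}"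
    if y: "y \<in> V" "distinct [u, v, y]" for y
  proof -
    have mem: "u \<in> V" "v \<in> V" "u \<noteq> y" "v \<noteq> y" "u \<noteq> v" "{u, v, y} \<subseteq> V"
      using V y by auto
    note adj = complete_drawing_adjacent[OF D mem(6) y(2)]
    show "arc_between (E {u, y} \<union> E {v, y}) (pos u) (pos v)"
      by (rule arc_between_join[OF complete_drawing_edge[OF D mem(1) y(1) mem(3)]
            arc_between_sym[OF complete_drawing_edge[OF D mem(2) y(1) mem(4)]] adj(3)])
    show "E {u, v} \<inter> (E {u, y} \<union> E {v, y}) \<subseteq> {pos u, pos v}"
      using adj(1,2) by blast
    show "pos y \<in> E {u, y} \<union> E {v, y} - {pos u, pos v}"
      using complete_drawing_ends(2)[OF D mem(1) y(1) mem(3)]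
        complete_drawing_neq[OF D mem(1) y(1) mem(3)] complete_drawing_neq[OF D mem(2) y(1) mem(4)]
      by auto
  qed
  have w: "w \<in> V" "distinct [u, v, w]" and x: "x \<in> V" "distinct [u, v, x]"
    using V by auto
  have uv: "arc_between (E {u, v}) (pos u) (pos v)"
    by (rule complete_drawing_edge[OF D]) (use V in auto)
  have "E {u, w} \<inter> E {u, x} \<subseteq> {pos u}" "E {v, w} \<inter> E {v, x} \<subseteq> {pos v}"
    by (rule complete_drawing_adjacent(1)[OF D]; use V in auto)+
  moreover have "E {u, w} \<inter> E {v, x} = {}" "E {v, w} \<inter> E {u, x} = {}"
    by (rule complete_drawing_disjoint[OF D]; use V in auto)+
  ultimately have cross: "(E {u, w} \<union> E {v, w}) \<inter> (E {u, x} \<union> E {v, x}) \<subseteq> {pos u, pos v}"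
    by blast
  show *: "E {u, v} - {pos u, pos v} \<subseteq> inside ((E {u, w} \<union> E {v, w}) \<union> (E {u, x} \<union> E {v, x}))"
    by (rule theta_chord_inside[OF uv via(1)[OF w] via(1)[OF x] via(2)[OF w] via(2)[OF x] cross
          via(3)[OF w] out(1) via(3)[OF x] out(2)])
  show "inside ((E {u, w} \<union> E {v, w}) \<union> (E {u, x} \<union> E {v, x})) =
      inside (E {u, v} \<union> (E {u, w} \<union> E {v, w})) \<union> inside (E {u, v} \<union> (E {u, x} \<union> E {v, x}))
      \<union> (E {u, v} - {pos u, pos v})"
    by (rule theta_chord_split[OF uv via(1)[OF w] via(1)[OF x] via(2)[OF w] via(2)[OF x] cross *])
qed

text \<open>The outer boundary of a plane K4 is a triangle around the fourth vertex. The only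
  alternative would be a 4-cycle with both diagonals inside it, and these would have to
  cross.\<close>

lemma K4_vertex_inside_triangle:
  assumes D: "complete_drawing V pos E" and V: "{a, b, c, d} \<subseteq> V" "distinct [a, b, c, d]"
  obtains u v w x where "{u, v, w, x} \<subseteq> {a, b, c, d}" "distinct [u, v, w, x]"
    "pos x \<in> inside (E {u, v} \<union> (E {u, w} \<union> E {v, w}))"
proof (rule ccontr)
  note found = that
  assume "\<not> thesis"
  then have outer: "pos x \<notin> inside (E {u, v} \<union> (E {u, w} \<union> E {v, w}))"
    if "{u, v, w, x} \<subseteq> {a, b, c, d}" "distinct [u, v, w, x]" for u v w x
    using found[OF that] by blast
  let ?Q = "(E {a, c} \<union> E {b, c}) \<union> (E {a, d} \<union> E {b, d})"
  \<comment> \<open>With the roles of the pairs exchanged, \<open>K4_chord\<close> yields the same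
    4-cycle \<open>?Q\<close>, so the other diagonal lies inside it as well.\<close>
  have "E {c, d} - {pos c, pos d} \<subseteq> inside ((E {c, a} \<union> E {d, a}) \<union> (E {c, b} \<union> E {d, b}))"
    by (rule K4_chord(1)[OF D]; (rule outer)?; use V in auto)
  moreover have "(E {c, a} \<union> E {d, a}) \<union> (E {c, b} \<union> E {d, b}) = ?Q"
    by (simp add: insert_commute Un_ac)
  ultimately have T: "E {c, d} - {pos c, pos d} \<subseteq> inside ?Q"
    by simp
  have split: "inside ?Q = inside (E {a, b} \<union> (E {a, c} \<union> E {b, c})) \<union>
      inside (E {a, b} \<union> (E {a, d} \<union> E {b, d})) \<union> (E {a, b} - {pos a, pos b})"
    by (rule K4_chord(2)[OF D]; (rule outer)?; use V in auto)
  have cd: "arc_between (E {c, d}) (pos c) (pos d)"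
    by (rule complete_drawing_edge[OF D]) (use V in auto)
  have cl: "pos c \<in> closure (E {c, d} - {pos c, pos d})" "pos d \<in> closure (E {c, d} - {pos c, pos d})"
    using arc_between_subset_closure[OF cd] arc_between_ends[OF cd] by blast+
  then obtain t where t: "t \<in> E {c, d} - {pos c, pos d}"
    by (metis closure_empty empty_iff ex_in_conv)
  \<comment> \<open>Both triangles on \<open>a\<close>, \<open>b\<close> are treated at once:
    \<open>y\<close> is the end of the diagonal that is a corner of the triangle, \<open>z\<close>
    is the opposite end.\<close>
  have cut: "t \<notin> inside (E {a, b} \<union> (E {a, y} \<union> E {b, y}))" (is "t \<notin> inside ?C")
    if yz: "{a, b, y, z} \<subseteq> {a, b, c, d}" "distinct [a, b, y, z]" "E {y, z} = E {c, d}"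
      "{pos y, pos z} = {pos c, pos d}" "pos z \<in> closure (E {c, d} - {pos c, pos d})" for y z
  proof
    assume t_in: "t \<in> inside ?C"
    have sub: "{a, b, y, z} \<subseteq> V"
      using yz(1) V(1) by blast
    have "E {y, z} \<inter> E {a, b} = {}"
      by (rule complete_drawing_disjoint[OF D]; use sub yz(2) in auto)
    moreover have "E {a, y} \<inter> E {y, z} \<subseteq> {pos y}" "E {b, y} \<inter> E {y, z} \<subseteq> {pos y}"
      by (rule complete_drawing_adjacent(2)[OF D]; use sub yz(2) in auto)+
    ultimately have disj: "(E {c, d} - {pos c, pos d}) \<inter> ?C = {}"
      unfolding yz(3,4)[symmetric] by blast
    have "arc_between (E {a, b}) (pos a) (pos b)" "arc_between (E {a, y}) (pos a) (pos y)"
      "arc_between (E {b, y}) (pos b) (pos y)"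
      by (rule complete_drawing_edge[OF D]; use sub yz(2) in auto)+
    then have closed: "closed ?C"
      by (intro closed_Un compact_imp_closed) (rule arc_between_compact, assumption)+
    have "E {c, d} - {pos c, pos d} \<subseteq> inside ?C"
      by (rule connected_subset_inside[OF arc_between_connected_interior[OF cd] disj t t_in])
    \<comment> \<open>The diagonal runs inside the triangle, so its end \<open>pos z\<close> is
      inside or on the boundary. It is on no edge of the triangle, hence inside, against the
      assumption.\<close>
    then have "pos z \<in> ?C \<union> inside ?C"
      using yz(5) closure_inside_subset[OF closed] closure_mono by blast
    moreover have "pos z \<notin> E {a, b}" "pos z \<notin> E {a, y}" "pos z \<notin> E {b, y}"
      by (rule vertex_not_on_edge[OF D]; use sub yz(2) in auto)+
    moreover have "pos z \<notin> inside ?C"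
      by (rule outer[OF yz(1,2)])
    ultimately show False
      by blast
  qed
  have "t \<notin> inside (E {a, b} \<union> (E {a, c} \<union> E {b, c}))"
    by (rule cut[of c d]) (use V cl in auto)
  moreover have "t \<notin> inside (E {a, b} \<union> (E {a, d} \<union> E {b, d}))"
    by (rule cut[of d c]) (use V cl in \<open>auto simp: insert_commute\<close>)
  moreover have "E {a, b} \<inter> E {c, d} = {}"
    by (rule complete_drawing_disjoint[OF D V])
  ultimately show False
    using T split t by blast
qed

lemma no_complete_drawing_K5:
  assumes "card V = 5"
  shows "\<not> complete_drawing V pos E"
proof
  assume D: "complete_drawing V pos E"
  have "finite V"
    using assms card.infinite by fastforce
  then obtain xs where xs: "set xs = V" "distinct xs"
    using finite_distinct_list by blast
  then have "length xs = Suc (Suc (Suc (Suc (Suc 0))))"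
    using assms distinct_card by fastforce
  then obtain e a b c d where "xs = [e, a, b, c, d]"
    unfolding length_Suc_conv by auto
  then have V: "V = {e, a, b, c, d}" and dist: "distinct [e, a, b, c, d]"
    using xs by auto
  let ?W = "{a, b, c, d}"
  have W: "?W = V - {e}" and e: "e \<in> V"
    using V dist by auto
  \<comment> \<open>Inversion at \<open>pos e\<close>. Since \<open>inverse 0 = 0\<close>, it is
    injective on the whole plane, although continuity is claimed only away from
    \<open>pos e\<close>.\<close>
  define f where "f z = inverse (z - pos e)" for z
  have f_inj: "inj f"
    unfolding f_def inj_def by simp
  have f_cont: "continuous_on S f" if "pos e \<notin> S" for S
    unfolding f_def using that by (intro continuous_intros) auto
  have off: "pos e \<notin> E {u, v}" if "u \<in> ?W" "v \<in> ?W" "u \<noteq> v" for u v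
    by (rule vertex_not_on_edge[OF D]) (use that e in \<open>auto simp: W\<close>)
  \<comment> \<open>Edges among the other four vertices avoid \<open>pos e\<close>, so inversion
    turns them into a drawing of K4.\<close>
  have D': "complete_drawing ?W (f \<circ> pos) (\<lambda>A. f ` E A)"
    unfolding complete_drawing_def
  proof (intro conjI ballI impI)
    have "inj_on pos V"
      using D unfolding complete_drawing_def by blast
    then have "inj_on pos ?W"
      by (rule inj_on_subset) (simp add: W)
    then show "inj_on (f \<circ> pos) ?W"
      by (rule comp_inj_on) (rule inj_on_subset[OF f_inj subset_UNIV])
  next
    fix u v assume uv: "u \<in> ?W" "v \<in> ?W" "u \<noteq> v"
    then have "u \<in> V" "v \<in> V"
      unfolding W by blast+
    then show "arc_between (f ` E {u, v}) ((f \<circ> pos) u) ((f \<circ> pos) v)"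
      unfolding comp_def
      by (intro arc_between_image f_cont off uv complete_drawing_edge[OF D]
          inj_on_subset[OF f_inj subset_UNIV])
  next
    fix u v x y assume *: "u \<in> ?W" "v \<in> ?W" "x \<in> ?W" "y \<in> ?W" "u \<noteq> v" "x \<noteq> y" "{u, v} \<noteq> {x, y}"
    then have "u \<in> V" "v \<in> V" "x \<in> V" "y \<in> V"
      unfolding W by blast+
    then have "E {u, v} \<inter> E {x, y} \<subseteq> pos ` ({u, v} \<inter> {x, y})"
      using D *(5-7) unfolding complete_drawing_def by blast
    then have "f ` (E {u, v} \<inter> E {x, y}) \<subseteq> f ` pos ` ({u, v} \<inter> {x, y})"
      by (rule image_mono)
    then show "f ` E {u, v} \<inter> f ` E {x, y} \<subseteq> (f \<circ> pos) ` ({u, v} \<inter> {x, y})"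
      by (simp only: image_comp image_Int[OF f_inj])
  qed
  have dist4: "distinct [a, b, c, d]"
    using dist by simp
  obtain u v w x where sub: "{u, v, w, x} \<subseteq> ?W" and di: "distinct [u, v, w, x]"
    and ins: "(f \<circ> pos) x \<in> inside (f ` E {u, v} \<union> (f ` E {u, w} \<union> f ` E {v, w}))"
    by (rule K4_vertex_inside_triangle[OF D' subset_refl dist4])
  define C where "C = E {u, v} \<union> (E {u, w} \<union> E {v, w})"
  \<comment> \<open>The image of \<open>S\<close> is connected, avoids the inverted triangle and
    contains a point inside it, so it would be bounded. But \<open>S\<close> comes arbitrarily close
    to \<open>pos e\<close>, where \<open>f\<close> is unbounded.\<close>
  define S where "S = E {e, x} - {pos e}"
  have subV: "{u, v, w, x} \<subseteq> V - {e}"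
    using sub unfolding W .
  have ex: "arc_between (E {e, x}) (pos e) (pos x)"
    by (rule complete_drawing_edge[OF D]) (use subV e in auto)
  have "arc_between (E {u, v}) (pos u) (pos v)" "arc_between (E {u, w}) (pos u) (pos w)"
      "arc_between (E {v, w}) (pos v) (pos w)"
    by (rule complete_drawing_edge[OF D]; use subV di in auto)+
  then have "compact C"
    unfolding C_def by (intro compact_Un) (rule arc_between_compact, assumption)+
  moreover have "pos e \<notin> C"
    unfolding C_def using off[of u v] off[of u w] off[of v w] sub di by simp
  ultimately have "bounded (f ` C)"
    using f_cont compact_continuous_image compact_imp_bounded by blast
  have "connected S"
    by (rule connected_intermediate_closure[OF arc_between_connected_interior[OF ex]])
       (use arc_between_subset_closure[OF ex] in \<open>auto simp: S_def\<close>)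
  then have "connected (f ` S)"
    by (intro connected_continuous_image f_cont) (auto simp: S_def)
  moreover have "E {e, x} \<inter> E {u, v} = {}" "E {e, x} \<inter> E {u, w} = {}" "E {e, x} \<inter> E {v, w} = {}"
    by (rule complete_drawing_disjoint[OF D]; use subV e di in auto)+
  then have "S \<inter> C = {}"
    unfolding S_def C_def by blast
  then have "f ` S \<inter> f ` C = {}"
    unfolding image_Int[OF f_inj, symmetric] by simp
  moreover have "f (pos x) \<in> f ` S"
    using arc_between_ends[OF ex] arc_between_neq[OF ex] by (auto simp: S_def)
  moreover have "f (pos x) \<in> inside (f ` C)"
    using ins by (simp add: C_def image_Un)
  ultimately have "f ` S \<subseteq> inside (f ` C)"
    by (rule connected_subset_inside)
  then have "bounded (f ` S)"
    using bounded_inside[OF \<open>bounded (f ` C)\<close>] bounded_subset by blast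
  then obtain B where "B > 0" and B: "\<And>z. z \<in> S \<Longrightarrow> norm (f z) \<le> B"
    by (auto simp: bounded_pos)
  \<comment> \<open>A point of \<open>S\<close> within distance \<open>inverse B\<close> of
    \<open>pos e\<close> has an image of norm greater than \<open>B\<close>.\<close>
  have "pos e \<in> closure (E {e, x} - {pos e, pos x})"
    using arc_between_subset_closure[OF ex] arc_between_ends(1)[OF ex] by (rule subsetD)
  also have "\<dots> \<subseteq> closure S"
    by (rule closure_mono) (auto simp: S_def)
  finally obtain z where z: "z \<in> S" "dist z (pos e) < inverse B"
    using \<open>B > 0\<close> by (meson closure_approachable positive_imp_inverse_positive)
  have "0 < dist z (pos e)"
    using z(1) by (simp add: S_def)
  then have "inverse (inverse B) < inverse (dist z (pos e))"
    using z(2) by (rule less_imp_inverse_less[rotated])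
  then have "B < norm (f z)"
    by (simp add: f_def norm_inverse dist_norm)
  then show False
    using B[OF z(1)] by simp
qed

text \<open>A drawing prescribes the ends of a curve only as an unordered pair; the symmetry of
  \<open>arc_between\<close> absorbs the unknown direction.\<close>

lemma planar_drawing_edge:
  assumes "planar_drawing H pos \<gamma>" "(u, v) \<in> arcs_ends H"
  shows "arc_between (path_image (\<gamma> {u, v})) (pos u) (pos v)"
proof -
  note edge = bspec[OF conjunct1[OF conjunct2[OF assms(1)[unfolded planar_drawing_def]]] assms(2),
      unfolded prod.case]
  have arc: "arc (\<gamma> {u, v})"
    using edge by (rule conjunct1)
  have ends: "{pathstart (\<gamma> {u, v}), pathfinish (\<gamma> {u, v})} = {pos u, pos v}"
    using edge[THEN conjunct2] by (rule conjunct1)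
  have "arc_between (path_image (\<gamma> {u, v})) (pathstart (\<gamma> {u, v})) (pathfinish (\<gamma> {u, v}))"
    using arc unfolding arc_between_def by blast
  moreover have "pathstart (\<gamma> {u, v}) = pos u \<and> pathfinish (\<gamma> {u, v}) = pos v \<or>
      pathstart (\<gamma> {u, v}) = pos v \<and> pathfinish (\<gamma> {u, v}) = pos u"
    using ends unfolding doubleton_eq_iff .
  ultimately show ?thesis
    by (metis arc_between_sym)
qed

lemma planar_drawing_crossing:
  assumes "planar_drawing H pos \<gamma>" "(u, v) \<in> arcs_ends H" "(x, y) \<in> arcs_ends H"
    "{u, v} \<noteq> {x, y}"
  shows "path_image (\<gamma> {u, v}) \<inter> path_image (\<gamma> {x, y}) \<subseteq> pos ` ({u, v} \<inter> {x, y})"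
proof -
  have "\<forall>(x, y) \<in> arcs_ends H. {u, v} \<noteq> {x, y} \<longrightarrow>
      path_image (\<gamma> {u, v}) \<inter> path_image (\<gamma> {x, y}) \<subseteq> pos ` ({u, v} \<inter> {x, y})"
    using bspec[OF conjunct2[OF conjunct2[OF assms(1)[unfolded planar_drawing_def]]] assms(2)]
    unfolding prod.case .
  from bspec[OF this assms(3)] assms(4) show ?thesis
    unfolding prod.case by (rule mp)
qed

lemma planar_no_K5:
  assumes "planar H" "K \<subseteq> verts H" "card K = 5"
    and adj: "\<And>u v. \<lbrakk>u \<in> K; v \<in> K; u \<noteq> v\<rbrakk> \<Longrightarrow> (u, v) \<in> arcs_ends H"
  shows False
proof -
  obtain pos \<gamma> where dr: "planar_drawing H pos \<gamma>"
    using assms(1) unfolding planar_def by blast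
  have "complete_drawing K pos (\<lambda>A. path_image (\<gamma> A))"
    unfolding complete_drawing_def
  proof (intro conjI ballI impI)
    have "inj_on pos (verts H)"
      using dr unfolding planar_drawing_def by (rule conjunct1)
    then show "inj_on pos K"
      using assms(2) by (rule inj_on_subset)
  qed (intro planar_drawing_edge[OF dr] planar_drawing_crossing[OF dr] adj; assumption)+
  then show False
    using no_complete_drawing_K5 assms(3) by blast
qed

section \<open>Straight-line drawings of graphs whose components have at most four vertices\<close>

section \<open>Drawing disjoint copies of K4\<close>

text \<open>The imaginary part is the determinant of the vectors \<open>b - a\<close> and
  \<open>c - a\<close>, so the three points are not collinear. At a common point \<open>z\<close>
  the determinant of \<open>z - a\<close> and \<open>c - a\<close> is both zero and \<open>s\<close>
  times the given one, hence \<open>s = 0\<close>.\<close>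

lemma segments_meet_at_common_end:
  fixes a b c :: complex
  assumes "Im (cnj (b - a) * (c - a)) \<noteq> 0"
  shows "closed_segment a b \<inter> closed_segment a c \<subseteq> {a}"
proof
  fix z assume z: "z \<in> closed_segment a b \<inter> closed_segment a c"
  obtain s where s: "z = (1 - s) *\<^sub>R a + s *\<^sub>R b"
    using z by (auto simp: in_segment)
  obtain t where t: "z = (1 - t) *\<^sub>R a + t *\<^sub>R c"
    using z by (auto simp: in_segment)
  have sz: "z - a = s *\<^sub>R (b - a)"
    using s by (simp add: algebra_simps)
  have tz: "z - a = t *\<^sub>R (c - a)"
    using t by (simp add: algebra_simps)
  have "s * Im (cnj (b - a) * (c - a)) = Im (cnj (z - a) * (c - a))"
    unfolding sz by simp
  also have "\<dots> = 0"
    unfolding tz by (simp add: algebra_simps)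
  finally have "s = 0"
    using assms by simp
  then show "z \<in> {a}"
    using s by simp
qed

text \<open>A triangle with its centroid 0: the straight-line drawing of K4 with one inner vertex,
  contained in a vertical strip of width 2.\<close>

definition K4_point :: "nat \<Rightarrow> complex" where
  "K4_point i = [0, 1, \<i>, Complex (-1) (-1)] ! i"

lemma less_4_cases: "(i::nat) < 4 \<longleftrightarrow> i = 0 \<or> i = 1 \<or> i = 2 \<or> i = 3"
  by auto

lemma K4_point_simps [simp]:
  "K4_point 0 = 0" "K4_point 1 = 1" "K4_point (Suc 0) = 1" "K4_point 2 = \<i>" 
  "K4_point 3 = Complex (-1) (-1)"
  by (simp_all add: K4_point_def numeral_3_eq_3)

lemma K4_point_not_collinear:
  assumes "i < 4" "j < 4" "k < 4" "distinct [i, j, k]"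
  shows "Im (cnj (K4_point j - K4_point i) * (K4_point k - K4_point i)) \<noteq> 0"
  using assms unfolding less_4_cases by (elim disjE; simp)

text \<open>Of two disjoint edges one is a spoke at 0 and the other the opposite side of the
  triangle. The line through the spoke meets that side only beyond 0, so the parameter on the spoke
  leaves the unit interval.\<close>

lemma K4_point_segments_disjoint:
  assumes "i < 4" "j < 4" "k < 4" "l < 4" "distinct [i, j, k, l]"
  shows "closed_segment (K4_point i) (K4_point j) \<inter> closed_segment (K4_point k) (K4_point l) = {}"
proof -
  have False
    if z: "z \<in> closed_segment (K4_point i) (K4_point j)" "z \<in> closed_segment (K4_point k) (K4_point l)"
    for z
  proof -
    obtain s where s: "0 \<le> s" "s \<le> 1" "z = (1 - s) *\<^sub>R K4_point i + s *\<^sub>R K4_point j"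
      using z(1) by (auto simp: in_segment)
    obtain t where t: "0 \<le> t" "t \<le> 1" "z = (1 - t) *\<^sub>R K4_point k + t *\<^sub>R K4_point l"
      using z(2) by (auto simp: in_segment)
    have "(1 - s) * Re (K4_point i) + s * Re (K4_point j) = (1 - t) * Re (K4_point k) + t * Re (K4_point l)"
      "(1 - s) * Im (K4_point i) + s * Im (K4_point j) = (1 - t) * Im (K4_point k) + t * Im (K4_point l)"
      using s(3) t(3) by (metis complex.sel plus_complex.sel scaleR_complex.sel)+
    then show False
      using assms s(1,2) t(1,2) unfolding less_4_cases by (elim disjE; simp)
  qed
  then show ?thesis
    by blast
qed

lemma K4_point_Re: "i < 4 \<Longrightarrow> \<bar>Re (K4_point i)\<bar> \<le> 1"
  unfolding less_4_cases by auto

text \<open>An unordered pair determines the ordered pair only up to a swap, so the choice fixes the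
  segment but not its direction.\<close>

lemma linepath_of_pair_cases:
  fixes pos :: "'v \<Rightarrow> complex"
  defines "\<gamma> \<equiv> \<lambda>A. let p = SOME p. A = {fst p, snd p} in linepath (pos (fst p)) (pos (snd p))"
  shows "\<gamma> {u, v} = linepath (pos u) (pos v) \<or> \<gamma> {u, v} = linepath (pos v) (pos u)"
proof -
  define p where "p = (SOME p. {u, v} = {fst p, snd p})"
  have "{u, v} = {fst (u, v), snd (u, v)}"
    by simp
  then have "{u, v} = {fst p, snd p}"
    unfolding p_def by (rule someI)
  then have "u = fst p \<and> v = snd p \<or> u = snd p \<and> v = fst p"
    unfolding doubleton_eq_iff .
  moreover have "\<gamma> {u, v} = linepath (pos (fst p)) (pos (snd p))"
    unfolding \<gamma>_def Let_def p_def ..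
  ultimately show ?thesis
    by auto
qed

text \<open>The map \<open>c\<close> labels blocks that no edge leaves. Each block is placed on the
  points of its own translated copy of K4, and every edge is drawn as a segment.\<close>

lemma planar_disjoint_small_cliques:
  fixes c :: "'a \<Rightarrow> 'k"
  assumes fin: "finite (verts H)"
    and arcs: "\<And>u v. (u, v) \<in> arcs_ends H \<Longrightarrow> u \<in> verts H \<and> v \<in> verts H \<and> u \<noteq> v \<and> c u = c v"
    and small: "\<And>k. card {v \<in> verts H. c v = k} \<le> 4"
  shows "planar H"
proof -
  obtain n :: "'k \<Rightarrow> nat" where n: "inj_on n (c ` verts H)"
    using fin finite_imp_inj_to_nat_seg by (metis finite_imageI)
  have "\<forall>k. \<exists>h. inj_on h {v \<in> verts H. c v = k} \<and> h ` {v \<in> verts H. c v = k} \<subseteq> {..<4::nat}"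
  proof
    fix k
    show "\<exists>h. inj_on h {v \<in> verts H. c v = k} \<and> h ` {v \<in> verts H. c v = k} \<subseteq> {..<4::nat}"
      using card_le_inj[of "{v \<in> verts H. c v = k}" "{..<4::nat}"] fin small[of k] by auto
  qed
  from choice[OF this] obtain h
    where h: "\<forall>k. inj_on (h k) {v \<in> verts H. c v = k} \<and> h k ` {v \<in> verts H. c v = k} \<subseteq> {..<4::nat}"
    by (rule exE)
  define idx where "idx v = h (c v) v" for v
  have idx: "idx v < 4" if "v \<in> verts H" for v
    using h that unfolding idx_def by blast
  have idx_inj: "idx u \<noteq> idx v" if "u \<in> verts H" "v \<in> verts H" "c u = c v" "u \<noteq> v" for u v
  proof -
    have "inj_on (h (c v)) {w \<in> verts H. c w = c v}"
      using h by blast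
    then show ?thesis
      using that unfolding idx_def inj_on_def by auto
  qed
  \<comment> \<open>The copies have width 2, so shifts by multiples of 3 put different blocks into
    disjoint strips.\<close>
  define base :: "'a \<Rightarrow> complex" where "base v = of_nat (3 * n (c v))" for v
  define pos where "pos v = base v + K4_point (idx v)" for v
  have shift: "closed_segment (pos u) (pos v) = (+) (base u) ` closed_segment (K4_point (idx u)) (K4_point (idx v))"
    if "c u = c v" for u v
    using that by (simp add: pos_def base_def closed_segment_translation)
  have adj: "closed_segment (pos u) (pos v) \<inter> closed_segment (pos u) (pos w) \<subseteq> {pos u}"
    if "{u, v, w} \<subseteq> verts H" "distinct [u, v, w]" "c u = c v" "c u = c w" for u v w
  proof (rule segments_meet_at_common_end)
    have "Im (cnj (K4_point (idx v) - K4_point (idx u)) * (K4_point (idx w) - K4_point (idx u))) \<noteq> 0"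
      by (rule K4_point_not_collinear) (use that idx idx_inj in auto)
    then show "Im (cnj (pos v - pos u) * (pos w - pos u)) \<noteq> 0"
      using that by (simp add: pos_def base_def)
  qed
  have disj: "closed_segment (pos u) (pos v) \<inter> closed_segment (pos w) (pos x) = {}"
    if "{u, v, w, x} \<subseteq> verts H" "distinct [u, v, w, x]" "c u = c v" "c u = c w" "c u = c x" for u v w x
  proof -
    have "closed_segment (K4_point (idx u)) (K4_point (idx v)) \<inter>
        closed_segment (K4_point (idx w)) (K4_point (idx x)) = {}"
      by (rule K4_point_segments_disjoint) (use that idx idx_inj in auto)
    moreover have "base w = base u"
      using that by (simp add: base_def)
    ultimately show ?thesis
      using shift[of u v] shift[of w x] that by auto
  qed
  have strip: "\<bar>Re z - 3 * real (n (c u))\<bar> \<le> 1"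
    if "z \<in> closed_segment (pos u) (pos v)" "u \<in> verts H" "v \<in> verts H" "c u = c v" for u v z
  proof -
    let ?m = "3 * real (n (c u))"
    have "Re z \<in> closed_segment (Re (pos u)) (Re (pos v))"
      using that(1) by (auto simp: in_segment)
    also have "\<dots> \<subseteq> {?m - 1..?m + 1}"
      using K4_point_Re[OF idx[OF that(2)]] K4_point_Re[OF idx[OF that(3)]] that(4)
      by (intro closed_segment_subset) (auto simp: pos_def base_def)
    finally show ?thesis
      by auto
  qed
  \<comment> \<open>Degenerate segments with \<open>u = v\<close> or \<open>w = x\<close> are
    included, so this also separates single vertices from each other and from edges of other
    blocks.\<close>
  have apart: "closed_segment (pos u) (pos v) \<inter> closed_segment (pos w) (pos x) = {}"
    if "{u, v, w, x} \<subseteq> verts H" "c u = c v" "c w = c x" "c u \<noteq> c w" for u v w x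
  proof -
    have "n (c u) \<noteq> n (c w)"
      using n that unfolding inj_on_def by blast
    then have "\<bar>real (n (c u)) - real (n (c w))\<bar> \<ge> 1"
      by linarith
    then have "\<not> (\<bar>r - 3 * real (n (c u))\<bar> \<le> 1 \<and> \<bar>r - 3 * real (n (c w))\<bar> \<le> 1)" for r
      by linarith
    then show ?thesis
      using strip[of _ u v] strip[of _ w x] that by blast
  qed
  have pos_inj: "pos u \<noteq> pos v" if "u \<in> verts H" "v \<in> verts H" "u \<noteq> v" for u v
  proof (cases "c u = c v")
    case True
    have "inj_on K4_point {..<4}"
      by (auto simp: inj_on_def less_4_cases complex_eq_iff)
    then show ?thesis
      using True idx_inj[OF that(1,2) True that(3)] idx that by (auto simp: pos_def base_def inj_on_def)
  next
    case False
    then show ?thesis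
      using apart[of u u v v] that by auto
  qed
  \<comment> \<open>A curve indexed by an unordered edge may run in either direction.\<close>
  define \<gamma> where "\<gamma> A = (let p = SOME p. A = {fst p, snd p} in linepath (pos (fst p)) (pos (snd p)))" for A
  have \<gamma>: "\<gamma> {u, v} = linepath (pos u) (pos v) \<or> \<gamma> {u, v} = linepath (pos v) (pos u)" for u v
    unfolding \<gamma>_def by (rule linepath_of_pair_cases)
  have \<gamma>_image: "path_image (\<gamma> {u, v}) = closed_segment (pos u) (pos v)" for u v
    using \<gamma>[of u v] by (auto simp: closed_segment_commute)
  have edge: "arc (\<gamma> {u, v}) \<and> {pathstart (\<gamma> {u, v}), pathfinish (\<gamma> {u, v})} = {pos u, pos v} \<and>
      path_image (\<gamma> {u, v}) \<inter> pos ` verts H = {pos u, pos v}"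
    if "(u, v) \<in> arcs_ends H" for u v
  proof (intro conjI)
    note uv = arcs[OF that]
    show "arc (\<gamma> {u, v})"
      using \<gamma>[of u v] pos_inj[of u v] pos_inj[of v u] uv by auto
    show "{pathstart (\<gamma> {u, v}), pathfinish (\<gamma> {u, v})} = {pos u, pos v}"
      using \<gamma>[of u v] by auto
    have "pos w \<notin> closed_segment (pos u) (pos v)" if w: "w \<in> verts H" "w \<noteq> u" "w \<noteq> v" for w
    proof (cases "c w = c u")
      case True
      have "closed_segment (pos u) (pos v) \<inter> closed_segment (pos u) (pos w) \<subseteq> {pos u}"
        by (rule adj) (use uv w True in auto)
      then show ?thesis
        using pos_inj[of w u] uv w by auto
    next
      case False
      then show ?thesis
        using apart[of u v w w] uv w by auto
    qed
    then show "path_image (\<gamma> {u, v}) \<inter> pos ` verts H = {pos u, pos v}"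
      unfolding \<gamma>_image using uv by auto
  qed
  have cross: "path_image (\<gamma> {u, v}) \<inter> path_image (\<gamma> {x, y}) \<subseteq> pos ` ({u, v} \<inter> {x, y})"
    if "(u, v) \<in> arcs_ends H" "(x, y) \<in> arcs_ends H" and ne: "{u, v} \<noteq> {x, y}" for u v x y
  proof -
    note uv = arcs[OF that(1)] and xy = arcs[OF that(2)]
    show ?thesis
    proof (cases "c u = c x")
      case False
      then show ?thesis
        unfolding \<gamma>_image using apart[of u v x y] uv xy by auto
    next
      case True
      \<comment> \<open>Two different edges share at most one end. If they share one, both segments
        are read as starting there, so that \<open>adj\<close> applies.\<close>
      consider "distinct [u, v, x, y]" | "u = x" | "u = y" | "v = x" | "v = y"
        using uv xy by auto
      then show ?thesis
      proof cases
        case 1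
        have "closed_segment (pos u) (pos v) \<inter> closed_segment (pos x) (pos y) = {}"
          by (rule disj) (use 1 uv xy True in auto)
        then show ?thesis
          unfolding \<gamma>_image by blast
      next
        case 2
        have "closed_segment (pos u) (pos v) \<inter> closed_segment (pos u) (pos y) \<subseteq> {pos u}"
          by (rule adj) (use 2 ne uv xy in auto)
        then show ?thesis
          unfolding \<gamma>_image using 2 by auto
      next
        case 3
        have "closed_segment (pos u) (pos v) \<inter> closed_segment (pos u) (pos x) \<subseteq> {pos u}"
          by (rule adj) (use 3 ne uv xy in auto)
        then show ?thesis
          unfolding \<gamma>_image using 3 by (auto simp: closed_segment_commute)
      next
        case 4
        have "closed_segment (pos v) (pos u) \<inter> closed_segment (pos v) (pos y) \<subseteq> {pos v}"
          by (rule adj) (use 4 ne uv xy in auto)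
        then show ?thesis
          unfolding \<gamma>_image using 4 by (auto simp: closed_segment_commute)
      next
        case 5
        have "closed_segment (pos v) (pos u) \<inter> closed_segment (pos v) (pos x) \<subseteq> {pos v}"
          by (rule adj) (use 5 ne uv xy True in auto)
        then show ?thesis
          unfolding \<gamma>_image using 5 by (auto simp: closed_segment_commute)
      qed
    qed
  qed
  have inj: "inj_on pos (verts H)"
    using pos_inj by (auto simp: inj_on_def)
  have "planar_drawing H pos \<gamma>"
    unfolding planar_drawing_def
    by (intro conjI inj ballI case_prodI2 impI; hypsubst;
        (rule cross; assumption | rule edge[THEN conjunct1], assumption |
         rule edge[THEN conjunct2, THEN conjunct1], assumption |
         rule edge[THEN conjunct2, THEN conjunct2], assumption))
  then show ?thesis
    unfolding planar_def by blast
qed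

section \<open>Adjacency in the power graph of a group of exponent p, and the planarity
  criterion\<close>

section \<open>Power graphs of groups of exponent p\<close>

lemma verts_proper_power_graph: "verts (proper_power_graph G) = carrier G - {\<one>\<^bsub>G\<^esub>}"
  by (simp add: proper_power_graph_def power_graph_def pre_digraph.del_vert_simps)

lemma arcs_ends_proper_power_graph:
  "arcs_ends (proper_power_graph G) =
     {(a, b). a \<in> carrier G - {\<one>\<^bsub>G\<^esub>} \<and> b \<in> carrier G - {\<one>\<^bsub>G\<^esub>} \<and> a \<noteq> b \<and>
              (a \<in> generate G {b} \<or> b \<in> generate G {a})}"
  by (auto simp: proper_power_graph_def power_graph_def pre_digraph.del_vert_simps
      arcs_ends_def arc_to_ends_def)

lemma group_of_exponent_card_generate:
  assumes "group_of_exponent p G" "x \<in> carrier G - {\<one>\<^bsub>G\<^esub>}"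
  shows "card (generate G {x}) = p"
  using assms group.generate_pow_card[of G x] unfolding group_of_exponent_def by auto

text \<open>The subgroup generated by \<open>y\<close> lies in the one generated by
  \<open>x\<close>, and both have \<open>p\<close> elements, so they agree by counting.\<close>

lemma group_of_exponent_generate_eq:
  assumes G: "group_of_exponent p G" and fin: "finite (carrier G)"
    and x: "x \<in> carrier G - {\<one>\<^bsub>G\<^esub>}" and y: "y \<in> generate G {x}" "y \<noteq> \<one>\<^bsub>G\<^esub>"
  shows "generate G {y} = generate G {x}"
proof -
  interpret group G
    using G unfolding group_of_exponent_def by blast
  have sub: "generate G {x} \<subseteq> carrier G"
    using generate_incl x by auto
  have "generate G {y} \<subseteq> generate G {x}"
    using generate_subgroup_incl[of "{y}" "generate G {x}"] generate_is_subgroup[of "{x}"] x y by auto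
  moreover have "card (generate G {y}) = card (generate G {x})"
    using group_of_exponent_card_generate[OF G] x y sub by auto
  ultimately show ?thesis
    using card_subset_eq finite_subset[OF sub fin] by blast
qed

theorem theorem4p3:
  fixes p :: nat and G :: "('a, 'm) monoid_scheme"
  assumes "prime p"
    and "finite (carrier G)"
    and "group_of_exponent p G"
  shows "planar (proper_power_graph G) \<longleftrightarrow> p \<le> 5"
proof -
  interpret group G
    using assms(3) unfolding group_of_exponent_def by blast
  let ?V = "carrier G - {\<one>\<^bsub>G\<^esub>}"
  note gen_eq = group_of_exponent_generate_eq[OF assms(3,2)]
  \<comment> \<open>Adjacency becomes an equivalence relation restricted to distinct vertices, so
    the components are complete.\<close>
  have arcs_iff: "(u, v) \<in> arcs_ends (proper_power_graph G) \<longleftrightarrow>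
      u \<in> ?V \<and> v \<in> ?V \<and> u \<noteq> v \<and> generate G {u} = generate G {v}" for u v
  proof -
    have "(u \<in> generate G {v} \<or> v \<in> generate G {u}) \<longleftrightarrow> generate G {u} = generate G {v}"
      if "u \<in> ?V" "v \<in> ?V"
      using gen_eq[of u v] gen_eq[of v u] that generate.incl[of u "{u}" G] by blast
    then show ?thesis
      unfolding arcs_ends_proper_power_graph mem_Collect_eq prod.case by blast
  qed
  have card: "card (generate G {x} - {\<one>\<^bsub>G\<^esub>}) = p - 1" if "x \<in> ?V" for x
    using group_of_exponent_card_generate[OF assms(3) that] generate.one[of G "{x}"]
    by (simp add: card_Diff_singleton)
  have fin_gen: "finite (generate G {x})" if "x \<in> ?V" for x
    using finite_subset[OF generate_incl assms(2)] that by simp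
  show ?thesis
  proof
    assume planar: "planar (proper_power_graph G)"
    show "p \<le> 5"
    proof (rule ccontr)
      assume "\<not> p \<le> 5"
      obtain x where x: "x \<in> ?V"
        using assms(3) one_closed unfolding group_of_exponent_def by blast
      \<comment> \<open>From \<open>p\<close> at least 6, removing the identity leaves at least five
        elements, all of which generate the same subgroup.\<close>
      have "5 \<le> card (generate G {x} - {\<one>\<^bsub>G\<^esub>})"
        using card[OF x] \<open>\<not> p \<le> 5\<close> by simp
      then obtain K where K: "K \<subseteq> generate G {x} - {\<one>\<^bsub>G\<^esub>}" "card K = 5"
        by (rule obtain_subset_with_card_n)
      have gx: "generate G {x} \<subseteq> carrier G"
        using generate_incl x by auto
      show False
        using planar
      proof (rule planar_no_K5)
        show "K \<subseteq> verts (proper_power_graph G)"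
          unfolding verts_proper_power_graph using K gx by blast
        show "card K = 5" by fact
        fix u v assume "u \<in> K" "v \<in> K" "u \<noteq> v"
        have mem: "w \<in> ?V" "generate G {w} = generate G {x}" if "w \<in> K" for w
        proof -
          have w: "w \<in> generate G {x}" "w \<noteq> \<one>\<^bsub>G\<^esub>"
            using K(1) that by blast+
          then show "w \<in> ?V"
            using gx by blast
          show "generate G {w} = generate G {x}"
            by (rule gen_eq[OF x w])
        qed
        show "(u, v) \<in> arcs_ends (proper_power_graph G)"
          unfolding arcs_iff
          using mem[OF \<open>u \<in> K\<close>] mem[OF \<open>v \<in> K\<close>] \<open>u \<noteq> v\<close> by simp
      qed
    qed
  next
    assume "p \<le> 5"
    show "planar (proper_power_graph G)"
    \<comment> \<open>The block of a vertex is labelled by the subgroup that the vertex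
      generates.\<close>
    proof (rule planar_disjoint_small_cliques)
      show "finite (verts (proper_power_graph G))"
        using assms(2) by (simp add: verts_proper_power_graph)
      show "u \<in> verts (proper_power_graph G) \<and> v \<in> verts (proper_power_graph G) \<and>
          u \<noteq> v \<and> generate G {u} = generate G {v}"
        if "(u, v) \<in> arcs_ends (proper_power_graph G)" for u v
        using that unfolding arcs_iff verts_proper_power_graph by blast
      fix K
      show "card {v \<in> verts (proper_power_graph G). generate G {v} = K} \<le> 4"
      proof (cases "\<exists>v \<in> ?V. generate G {v} = K")
        case True
        then obtain x where x: "x \<in> ?V" "generate G {x} = K"
          by blast
        have "{v \<in> ?V. generate G {v} = K} \<subseteq> generate G {x} - {\<one>\<^bsub>G\<^esub>}"
          unfolding x(2) by (auto intro: generate.incl)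
        then have "card {v \<in> ?V. generate G {v} = K} \<le> card (generate G {x} - {\<one>\<^bsub>G\<^esub>})"
          by (rule card_mono[OF finite_Diff[OF fin_gen[OF x(1)]]])
        then show ?thesis
          unfolding verts_proper_power_graph card[OF x(1)] using \<open>p \<le> 5\<close> by linarith
      next
        \<comment> \<open>Labels that are not generated by a non-identity element belong to empty
          blocks.\<close>
        case False
        then have "{v \<in> ?V. generate G {v} = K} = {}"
          by blast
        then show ?thesis
          by (simp only: verts_proper_power_graph card.empty le0)
      qed
    qed
  qed
qed

end
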